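(* Let $\beta\in[0,1]$. For every polynomial $P\in S(\beta)$ with exactly one distinct critical point (i.e. such that the derivative $P'$ has exactly one distinct complex root), we have $d(P,\beta)\le 1-\frac13\beta(1-\beta)$.
   Context: For $\beta\in[0,1]$, $S(\beta)$ is the set of polynomials of degree at least $2$ with complex coefficients, with all roots in the closed unit disk $\{z\in\mathbb{C}: |z|\le 1\}$, and with at least one root at $\beta$. For $P\in S(\beta)$, $d(P,\beta)$ is the distance between $\beta$ and the closest root of the derivative $P'$, i.e. $d(P,\beta)=\min\{|\zeta-\beta| : P'(\zeta)=0\}$. *)

theory Defs
  imports Complex_Main "HOL-Computational_Algebra.Polynomial"
begin

definition S :: "real \<Rightarrow> complex poly set" where
  "S \<beta> = {P. degree P \<ge> 2 \<and> (\<forall>z. poly P z = 0 \<longrightarrow> norm z \<le> 1) \<and> poly P (of_real \<beta>) = 0}"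

definition critical_points :: "complex poly \<Rightarrow> complex set" where
  "critical_points P = {\<zeta>. poly (pderiv P) \<zeta> = 0}"

(* For degree P \<ge> 2 the set of critical points is finite and nonempty, so Min is the
   actual minimum. *)
definition d :: "complex poly \<Rightarrow> real \<Rightarrow> real" where
  "d P \<beta> = Min {norm (\<zeta> - of_real \<beta>) | \<zeta>. \<zeta> \<in> critical_points P}"

end

theory Submission
  imports Defs "HOL-Computational_Algebra.Fundamental_Theorem_Algebra"
begin

text \<open>
  A derivative whose only root is \<open>\<zeta>\<close> is a multiple of a power of \<open>z - \<zeta>\<close>, so \<open>P\<close> has the form
  \<open>a (z - \<zeta>)\<^sup>n + b\<close> and its roots are the vertices of a regular \<open>n\<close>-gon centred at \<open>\<zeta>\<close>
  with one vertex at \<open>\<beta>\<close> (lemma \<open>poly_eq_of_unique_critical_point\<close>).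

  Let \<open>r = \<bar>\<zeta> - \<beta>\<bar>\<close>. Rotate the vertex \<open>\<beta>\<close> about \<open>\<zeta>\<close> by \<open>\<phi>\<close> and by \<open>-\<phi>\<close>, where \<open>\<phi>\<close> is an angle of the \<open>n\<close>-gon. Both images lie in the unit disk,
  and averaging their squared moduli cancels the \<open>sin \<phi>\<close> terms, which gives
  \<open>\<beta>\<^sup>2 + 2 (1 - cos \<phi>) r (r - \<beta>) \<le> 1\<close> (lemma \<open>rotated_pair_bound\<close>). Every regular \<open>n\<close>-gon with
  \<open>n \<ge> 2\<close> has a vertex nearly opposite to the given one, in the sense that \<open>cos \<phi> \<le> -1/2\<close>
  (lemma \<open>obtuse_root_of_unity\<close>). Hence \<open>\<beta>\<^sup>2 + 3 r (r - \<beta>) \<le> 1\<close>, whatever \<open>n\<close> is: for \<open>r \<ge> \<beta>\<close>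
  this follows from \<open>2 (1 - cos \<phi>) \<ge> 3\<close>, and for \<open>r < \<beta>\<close> it is trivial since \<open>\<beta> \<le> 1\<close>. So the
  triangle, which has \<open>cos \<phi> = -1/2\<close>, is the worst case. Solving it for \<open>r\<close> gives the bound
  (lemma \<open>triangle_radius_bound\<close>).
\<close>

lemma poly_eq_power_of_unique_root:
  fixes Q :: "complex poly"
  assumes "{z. poly Q z = 0} = {\<zeta>}"
  obtains c where "c \<noteq> 0" "Q = smult c ([:- \<zeta>, 1:] ^ degree Q)"
proof -
  have "\<zeta> + 1 \<notin> {z. poly Q z = 0}"
    unfolding assms by simp
  then have "Q \<noteq> 0"
    by auto
  then obtain q where Q: "Q = [:- \<zeta>, 1:] ^ order \<zeta> Q * q" and q: "\<not> [:- \<zeta>, 1:] dvd q"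
    using order_decomp by blast
  have "poly q z \<noteq> 0" for z
  proof
    assume z: "poly q z = 0"
    then have "poly Q z = 0"
      by (subst Q) simp
    then have "z = \<zeta>"
      using assms by blast
    then show False
      using q z by (simp add: poly_eq_0_iff_dvd)
  qed
  then have "constant (poly q)"
    using fundamental_theorem_of_algebra by blast
  then have "degree q = 0"
    by (simp add: constant_degree)
  then obtain c where c: "q = [:c:]"
    by (rule degree_eq_zeroE)
  have "c \<noteq> 0"
    using c q by auto
  have Q': "Q = smult c ([:- \<zeta>, 1:] ^ order \<zeta> Q)"
    using Q c by simp
  then have "degree Q = order \<zeta> Q"
    by (metis \<open>c \<noteq> 0\<close> degree_linear_power degree_smult_eq)
  then show thesis
    using that \<open>c \<noteq> 0\<close> Q' by metis
qed

lemma poly_eq_of_unique_critical_point: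
  fixes P :: "complex poly"
  assumes "critical_points P = {\<zeta>}" and "degree P > 0"
  obtains a b where "\<And>z. poly P z = a * (z - \<zeta>) ^ degree P + b"
proof -
  let ?n = "degree P"
  obtain c where c: "pderiv P = smult c ([:- \<zeta>, 1:] ^ (?n - 1))"
    using poly_eq_power_of_unique_root[of "pderiv P" \<zeta>] assms(1)
    by (metis critical_points_def degree_pderiv)
  define R where "R = P - smult (c / of_nat ?n) ([:- \<zeta>, 1:] ^ ?n)"
  obtain m where m: "?n = Suc m"
    using assms(2) gr0_implies_Suc by blast
  have "pderiv ([:- \<zeta>, 1:] ^ Suc m) = smult (of_nat (Suc m)) ([:- \<zeta>, 1:] ^ m)"
    by (subst pderiv_power_Suc) (simp add: pderiv_pCons)
  then have "pderiv R = 0"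
    using c unfolding R_def m by (simp add: pderiv_diff pderiv_smult del: of_nat_Suc power_Suc)
  then obtain b where "R = [:b:]"
    using pderiv_iszero by blast
  then have "poly R z = b" for z
    by simp
  then have "poly P z = c / of_nat ?n * (z - \<zeta>) ^ ?n + b" for z
    by (simp add: R_def algebra_simps)
  then show thesis
    by (rule that)
qed

text \<open>For odd \<open>n\<close> the root of unity nearest to \<open>-1\<close> is at an angle \<open>\<pi> - \<pi>/n \<ge> 2\<pi>/3\<close>; for even
  \<open>n\<close> it is \<open>-1\<close> itself.\<close>

lemma obtuse_root_of_unity:
  assumes "n \<ge> 2"
  obtains \<phi> where "cis \<phi> ^ n = 1" "cos \<phi> \<le> -1/2"
proof
  let ?k = "n div 2"
  let ?\<phi> = "2 * pi * real ?k / real n"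
  have "cis ?\<phi> ^ n = cis (2 * pi * real ?k)"
    using assms by (simp add: DeMoivre)
  also have "\<dots> = 1"
    by (rule cis_multiple_2pi) simp
  finally show "cis ?\<phi> ^ n = 1" .
  have k: "n \<le> 3 * ?k" "2 * ?k \<le> n"
    using assms by linarith+
  have "real n \<le> 3 * real ?k" "2 * real ?k \<le> real n"
    using k by linarith+
  then have "2 * pi / 3 \<le> ?\<phi>" "?\<phi> \<le> pi"
    using assms by (simp_all add: field_simps)
  then have "cos ?\<phi> \<le> cos (2 * pi / 3)"
    by (intro cos_monotone_0_pi_le) auto
  then show "cos ?\<phi> \<le> -1/2"
    by (simp add: cos_120)
qed

text \<open>With \<open>w = \<beta> - \<zeta>\<close>, the mean of the two squared moduli is exactly
  \<open>\<beta>\<^sup>2 + 2 (1 - cos \<phi>) (\<bar>w\<bar>\<^sup>2 - \<beta> Re w)\<close>, and \<open>Re w \<le> \<bar>w\<bar>\<close>.\<close>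

lemma rotated_pair_bound:
  fixes \<beta> \<phi> :: real and \<zeta> :: complex
  defines "r \<equiv> norm (\<zeta> - of_real \<beta>)"
  assumes "0 \<le> \<beta>"
    and "norm (\<zeta> + (of_real \<beta> - \<zeta>) * cis \<phi>) \<le> 1"
    and "norm (\<zeta> + (of_real \<beta> - \<zeta>) * cis (- \<phi>)) \<le> 1"
  shows "\<beta>\<^sup>2 + 2 * (1 - cos \<phi>) * (r * (r - \<beta>)) \<le> 1"
proof -
  define a b where "a = \<beta> - Re \<zeta>" and "b = - Im \<zeta>"
  define x y where "x = cos \<phi>" and "y = sin \<phi>"
  have xy: "x\<^sup>2 + y\<^sup>2 = 1"
    by (simp add: x_def y_def)
  have r: "r\<^sup>2 = a\<^sup>2 + b\<^sup>2"
    by (simp add: r_def a_def b_def cmod_power2 power2_commute)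
  have "a \<le> r"
    using abs_Re_le_cmod[of "\<zeta> - of_real \<beta>"] by (simp add: r_def a_def)
  have \<zeta>: "Re \<zeta> = \<beta> - a" "Im \<zeta> = - b"
    by (simp_all add: a_def b_def)
  have plus: "(\<beta> - a + (a * x - b * y))\<^sup>2 + (- b + (a * y + b * x))\<^sup>2 \<le> 1"
    using power_mono[OF assms(3), of 2] by (simp add: cmod_power2 \<zeta> x_def y_def)
  have minus: "(\<beta> - a + (a * x + b * y))\<^sup>2 + (- b + (b * x - a * y))\<^sup>2 \<le> 1"
    using power_mono[OF assms(4), of 2] by (simp add: cmod_power2 \<zeta> x_def y_def)
  have "(\<beta> - a + (a * x - b * y))\<^sup>2 + (- b + (a * y + b * x))\<^sup>2
      + ((\<beta> - a + (a * x + b * y))\<^sup>2 + (- b + (b * x - a * y))\<^sup>2)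
      = 2 * (\<beta>\<^sup>2 + 2 * (1 - x) * (a\<^sup>2 + b\<^sup>2 - \<beta> * a)) + 2 * (a\<^sup>2 + b\<^sup>2) * (x\<^sup>2 + y\<^sup>2 - 1)"
    by (simp add: power2_eq_square algebra_simps)
  then have mean: "\<beta>\<^sup>2 + 2 * (1 - x) * (r\<^sup>2 - \<beta> * a) \<le> 1"
    using plus minus xy r by simp
  have "r * (r - \<beta>) \<le> r\<^sup>2 - \<beta> * a"
    using mult_left_mono[OF \<open>a \<le> r\<close> \<open>0 \<le> \<beta>\<close>] by (simp add: power2_eq_square algebra_simps)
  then have "2 * (1 - x) * (r * (r - \<beta>)) \<le> 2 * (1 - x) * (r\<^sup>2 - \<beta> * a)"
    by (intro mult_left_mono) (simp_all add: x_def)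
  then show ?thesis
    using mean by (simp add: x_def)
qed

text \<open>At \<open>r\<^sub>0 = 1 - t\<close> with \<open>t = \<beta> (1 - \<beta>) / 3\<close> the quantity \<open>\<beta>\<^sup>2 + 3 r (r - \<beta>) - 1\<close> equals
  \<open>(2 - \<beta>) (1 - \<beta>)\<^sup>2 + 3 t\<^sup>2 \<ge> 0\<close>, and it increases strictly in \<open>r\<close> from there on because
  \<open>r\<^sub>0 \<ge> \<beta>\<close> and \<open>r\<^sub>0 > 0\<close>.\<close>

lemma triangle_radius_bound:
  fixes \<beta> r :: real
  assumes "0 \<le> \<beta>" "\<beta> \<le> 1" "\<beta>\<^sup>2 + 3 * (r * (r - \<beta>)) \<le> 1"
  shows "r \<le> 1 - 1/3 * \<beta> * (1 - \<beta>)"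
proof (rule ccontr)
  define t where "t = \<beta> * (1 - \<beta>) / 3"
  have three_t: "3 * t = \<beta> * (1 - \<beta>)"
    by (simp add: t_def)
  assume "\<not> r \<le> 1 - 1/3 * \<beta> * (1 - \<beta>)"
  then have r: "1 - t < r"
    by (simp add: t_def)
  have "\<beta> * (1 - \<beta>) \<le> 1 - \<beta>"
    using mult_right_mono[of \<beta> 1 "1 - \<beta>"] assms by simp
  then have t: "\<beta> \<le> 1 - t" "0 < 1 - t"
    using assms unfolding t_def by simp_all
  have "(1 - t) * (1 - t - \<beta>) \<le> (1 - t) * (r - \<beta>)"
    using r t by (intro mult_left_mono) auto
  also have "\<dots> < r * (r - \<beta>)"
    using r t by (intro mult_strict_right_mono) auto
  finally have less: "(1 - t) * (1 - t - \<beta>) < r * (r - \<beta>)" .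
  have "\<beta>\<^sup>2 + 3 * ((1 - t) * (1 - t - \<beta>)) - 1 = (2 - \<beta>) * (1 - \<beta> - 3 * t) + 3 * t\<^sup>2"
    by (simp add: power2_eq_square algebra_simps)
  also have "\<dots> = (2 - \<beta>) * (1 - \<beta>)\<^sup>2 + 3 * t\<^sup>2"
    unfolding three_t by (simp add: power2_eq_square algebra_simps)
  also have "\<dots> \<ge> 0"
    using assms by simp
  finally show False
    using less assms(3) by linarith
qed

theorem theorem8:
  fixes \<beta> :: real and P :: "complex poly"
  assumes "\<beta> \<in> {0..1}"
    and "P \<in> S \<beta>"
    and "card (critical_points P) = 1"
  shows "d P \<beta> \<le> 1 - 1/3 * \<beta> * (1 - \<beta>)"
proof -
  have \<beta>: "0 \<le> \<beta>" "\<beta> \<le> 1"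
    using assms(1) by auto
  have deg: "degree P \<ge> 2" and disk: "\<And>z. poly P z = 0 \<Longrightarrow> norm z \<le> 1"
    and root: "poly P (of_real \<beta>) = 0"
    using assms(2) by (auto simp: S_def)
  obtain \<zeta> where \<zeta>: "critical_points P = {\<zeta>}"
    using assms(3) card_1_singletonE by blast
  define r where "r = norm (\<zeta> - of_real \<beta>)"
  have "{norm (z - of_real \<beta>) | z. z \<in> critical_points P} = {r}"
    by (auto simp: \<zeta> r_def)
  then have d: "d P \<beta> = r"
    by (simp add: d_def)
  obtain a b where P: "\<And>z. poly P z = a * (z - \<zeta>) ^ degree P + b"
    using poly_eq_of_unique_critical_point[OF \<zeta>] deg by force
  obtain \<phi> where \<phi>: "cis \<phi> ^ degree P = 1" "cos \<phi> \<le> -1/2"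
    using obtuse_root_of_unity[OF deg] .
  have rotate: "norm (\<zeta> + (of_real \<beta> - \<zeta>) * \<omega>) \<le> 1" if "\<omega> ^ degree P = 1" for \<omega>
    using root that by (intro disk) (simp add: P power_mult_distrib)
  have "cis (- \<phi>) ^ degree P = 1"
    using \<phi>(1) by (metis cis_inverse inverse_1 power_inverse)
  then have bound: "\<beta>\<^sup>2 + 2 * (1 - cos \<phi>) * (r * (r - \<beta>)) \<le> 1"
    unfolding r_def using \<beta>(1) \<phi>(1) by (intro rotated_pair_bound rotate)
  have "\<beta>\<^sup>2 + 3 * (r * (r - \<beta>)) \<le> 1"
  proof (cases "\<beta> \<le> r")
    case True
    then have "3 * (r * (r - \<beta>)) \<le> 2 * (1 - cos \<phi>) * (r * (r - \<beta>))"
      using \<phi>(2) by (intro mult_right_mono) (auto simp: r_def)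
    then show ?thesis
      using bound by linarith
  next
    case False
    then have "r * (r - \<beta>) \<le> 0"
      by (simp add: r_def mult_nonneg_nonpos)
    moreover have "\<beta>\<^sup>2 \<le> 1"
      using \<beta> by (simp add: power_le_one)
    ultimately show ?thesis
      by linarith
  qed
  then show ?thesis
    using triangle_radius_bound[OF \<beta>] d by simp
qed

end
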